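(* For every $n,m\ge1$ there exists a matrix $D_{n,m}\in\mathbb R^{nm\times(n+m-1)}$ (called the L-duplicating matrix) such that for every Hankel matrix $A\in\mathcal A_{n,m}$, $$D_{n,m}\,vecL(A)=vec(A),$$ and it is given by $$D_{n,m}=\sum_{i=1}^n\sum_{j=1}^m\vec e_{n+m-1,i+j-1}^{\top}\otimes\vec e_{m,j}\otimes\vec e_{n,i}.$$
   Context: $\mathcal A_{n,m}\subset\mathbb R^{n\times m}$ is the space of (rectangular) Hankel matrices, i.e. matrices whose elements on the same skew-diagonal coincide: $[A]_{i,j}=a_{i+j-1}$ for some $a_1,\dots,a_{n+m-1}\in\mathbb R$. $vec(A)\in\mathbb R^{nm}$ is the column vector obtained by stacking the columns of $A$. For $A=(a_{i,j})\in\mathbb R^{n\times m}$, $vecL(A)=(a_{1,1},a_{2,1},\dots,a_{n,1},a_{n,2},\dots,a_{n,m})^{\top}\in\mathbb R^{n+m-1}$ (first column followed by the rest of the last row). $\vec e_{k,j}$ is the $j$-th canonical basis (column) vector of $\mathbb R^k$ and $\otimes$ is the Kronecker product. *)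

theory Defs
  imports "Jordan_Normal_Form.Matrix"
begin

(* Indices of the library's matrices and vectors start at 0.  The generating sequence a, the basis
   vectors and the summation ranges below keep the usual numbering from 1. *)

(* The entry in row i + 1 and column j + 1 is a_((i+1)+(j+1)-1) = a_(i+j+1). *)
definition hankel_mats :: "nat \<Rightarrow> nat \<Rightarrow> real mat set" where
  "hankel_mats n m =
     {A \<in> carrier_mat n m. \<exists>a :: nat \<Rightarrow> real. \<forall>i<n. \<forall>j<m. A $$ (i, j) = a (i + j + 1)}"

definition vec_mat :: "real mat \<Rightarrow> real vec" where
  "vec_mat A = foldr (@\<^sub>v) (cols A) vNil"

definition vecL_mat :: "real mat \<Rightarrow> real vec" where
  "vecL_mat A = col A 0 @\<^sub>v vec (dim_col A - 1) (\<lambda>k. A $$ (dim_row A - 1, k + 1))"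

(* The block in position (i, j) is A_(i,j) B. *)
definition kronecker :: "real mat \<Rightarrow> real mat \<Rightarrow> real mat" (infixl \<open>\<otimes>\<^sub>K\<close> 70) where
  "A \<otimes>\<^sub>K B = mat (dim_row A * dim_row B) (dim_col A * dim_col B)
     (\<lambda>(r, c). A $$ (r div dim_row B, c div dim_col B) * B $$ (r mod dim_row B, c mod dim_col B))"

(* The j-th canonical basis vector, 1 \<le> j \<le> k, as a k x 1 matrix. *)
definition basis_col :: "nat \<Rightarrow> nat \<Rightarrow> real mat" where
  "basis_col k j = mat_of_cols k [unit_vec k (j - 1)]"

end

theory Submission
  imports Defs
begin

text \<open>With 0-based positions, entry \<open>r\<close> of \<open>vec_mat A\<close> is the entry
  of \<open>A\<close> in row \<open>r mod n\<close> and column \<open>r div n\<close>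
  (\<open>vec_mat_eq\<close>), which for a Hankel matrix is
  \<open>a (r mod n + r div n + 1)\<close>. On the other side \<open>vecL_mat A\<close> lists the
  generating sequence \<open>a 1\<close>, ..., \<open>a (n + m - 1)\<close>, each index once
  (\<open>vecL_mat_hankel\<close>). So a duplicating matrix only has to select, in row
  \<open>r\<close>, the coordinate \<open>r div n + r mod n\<close>. The stated sum does this: each
  Kronecker term has a single nonzero entry, a 1 (\<open>index_duplication_term\<close>), and each
  row of the sum receives exactly one such entry.\<close>

lemma finsum_module_mat_closed:
  fixes M :: "'b \<Rightarrow> 'a :: comm_ring_1 mat"
  assumes "\<And>x. x \<in> F \<Longrightarrow> M x \<in> carrier_mat nr nc"
  shows "finsum (module_mat TYPE('a) nr nc) M F \<in> carrier_mat nr nc"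
proof -
  interpret abelian_group "module_mat TYPE('a) nr nc"
    by (rule abelian_group_mat)
  show ?thesis
    using finsum_closed[of M F] assms by (auto simp: module_mat_simps)
qed

text \<open>Carries the sum in the additive group of matrices of fixed size over to ordinary sums of
  scalars, entry by entry.\<close>

lemma index_finsum_module_mat:
  fixes M :: "'b \<Rightarrow> 'a :: comm_ring_1 mat"
  assumes "finite F" and "\<And>x. x \<in> F \<Longrightarrow> M x \<in> carrier_mat nr nc" and "r < nr" "c < nc"
  shows "finsum (module_mat TYPE('a) nr nc) M F $$ (r, c) = (\<Sum>x\<in>F. M x $$ (r, c))"
  using assms(1,2)
proof (induction F)
  interpret abelian_group "module_mat TYPE('a) nr nc"
    by (rule abelian_group_mat)
  case empty
  show ?case
    using assms(3,4) by (simp add: module_mat_simps)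
next
  interpret abelian_group "module_mat TYPE('a) nr nc"
    by (rule abelian_group_mat)
  case (insert x F)
  have "finsum (module_mat TYPE('a) nr nc) M (insert x F)
      = M x + finsum (module_mat TYPE('a) nr nc) M F"
    using finsum_insert[of F x M] insert by (auto simp: module_mat_simps)
  then show ?case
    using insert finsum_module_mat_closed[of F M nr nc] assms(3,4) by auto
qed

text \<open>Blocks of equal length \<open>n\<close> put position \<open>r\<close> at offset
  \<open>r mod n\<close> of block \<open>r div n\<close>.\<close>

lemma foldr_append_vec:
  assumes "\<And>v. v \<in> set vs \<Longrightarrow> dim_vec v = n"
  shows "foldr (@\<^sub>v) vs vNil = vec (n * length vs) (\<lambda>r. vs ! (r div n) $ (r mod n))"
  using assms
proof (induction vs)
  case Nil
  show ?case by auto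
next
  case (Cons v vs)
  then have dim: "dim_vec v = n"
    and IH: "foldr (@\<^sub>v) vs vNil = vec (n * length vs) (\<lambda>r. vs ! (r div n) $ (r mod n))"
    by auto
  show ?case
  proof (rule eq_vecI)
    fix r assume "r < dim_vec (vec (n * length (v # vs)) (\<lambda>r. (v # vs) ! (r div n) $ (r mod n)))"
    then have r: "r < n * length (v # vs)" by simp
    then have n: "n > 0" by (cases n) auto
    show "foldr (@\<^sub>v) (v # vs) vNil $ r
        = vec (n * length (v # vs)) (\<lambda>r. (v # vs) ! (r div n) $ (r mod n)) $ r"
    proof (cases "r < n")
      case True
      then show ?thesis using r dim by (simp add: IH)
    next
      case False
      \<comment> \<open>Skipping the first block lowers the quotient by one and keeps the remainder,
        so the induction hypothesis applies at \<open>r - n\<close>.\<close>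
      then have "r div n = Suc ((r - n) div n)" "r mod n = (r - n) mod n"
        using n by (simp_all add: le_div_geq le_mod_geq)
      then show ?thesis using False r dim by (simp add: IH)
    qed
  qed (simp add: IH dim)
qed

lemma vec_mat_eq:
  "vec_mat A = vec (dim_row A * dim_col A) (\<lambda>r. A $$ (r mod dim_row A, r div dim_row A))"
proof -
  have "r mod dim_row A < dim_row A \<and> r div dim_row A < dim_col A"
    if "r < dim_row A * dim_col A" for r
    using that by (cases "dim_row A = 0") (auto simp: less_mult_imp_div_less mult.commute)
  moreover have "vec_mat A = vec (dim_row A * dim_col A)
      (\<lambda>r. cols A ! (r div dim_row A) $ (r mod dim_row A))"
    unfolding vec_mat_def by (subst foldr_append_vec[of _ "dim_row A"]) (auto simp: cols_def)
  ultimately show ?thesis by auto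
qed

text \<open>Down the first column the Hankel index runs from 1 to \<open>n\<close>. The rest of the
  last row continues it without gap, since entry \<open>(n - 1, k + 1)\<close> is
  \<open>a (n + k + 1)\<close>.\<close>

lemma vecL_mat_hankel:
  assumes "A \<in> carrier_mat n m" and "n \<ge> 1" and "m \<ge> 1"
    and "\<And>i j. i < n \<Longrightarrow> j < m \<Longrightarrow> A $$ (i, j) = a (i + j + 1)"
  shows "vecL_mat A = vec (n + m - 1) (\<lambda>k. a (k + 1))"
  using assms by (intro eq_vecI) (auto simp: vecL_mat_def)

abbreviation duplication_term :: "nat \<Rightarrow> nat \<Rightarrow> nat \<Rightarrow> nat \<Rightarrow> real mat" where
  "duplication_term n m i j \<equiv>
     (basis_col (n + m - 1) (i + j - 1))\<^sup>T \<otimes>\<^sub>K basis_col m j \<otimes>\<^sub>K basis_col n i"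

lemma duplication_term_carrier: "duplication_term n m i j \<in> carrier_mat (n * m) (n + m - 1)"
  by (rule carrier_matI) (simp_all add: kronecker_def basis_col_def)

text \<open>The last factor has \<open>n\<close> rows, so \<open>r\<close> splits into row
  \<open>r div n\<close> of the middle factor and row \<open>r mod n\<close> of the last. Both have
  one column, so \<open>c\<close> indexes the row vector alone, whose 1 sits at the 0-based place
  \<open>i + j - 2\<close>.\<close>

lemma index_duplication_term:
  assumes "i \<in> {1..n}" "j \<in> {1..m}" "r < n * m" "c < n + m - 1"
  shows "duplication_term n m i j $$ (r, c)
    = of_bool (i = r mod n + 1 \<and> j = r div n + 1 \<and> c = r div n + r mod n)"
proof -
  have "r div n < m" "r mod n < n"
    using assms by (auto simp: less_mult_imp_div_less mult.commute)
  then show ?thesis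
    using assms by (auto simp: kronecker_def basis_col_def mat_of_cols_index mult.commute split: if_splits)
qed

theorem theorem3p3:
  fixes n m :: nat
  assumes "n \<ge> 1" and "m \<ge> 1"
  shows "\<exists>D \<in> carrier_mat (n * m) (n + m - 1).
    (\<forall>A \<in> hankel_mats n m. D *\<^sub>v vecL_mat A = vec_mat A) \<and>
    D = (\<Oplus>\<^bsub>module_mat TYPE(real) (n * m) (n + m - 1)\<^esub> i\<in>{1..n}.
          \<Oplus>\<^bsub>module_mat TYPE(real) (n * m) (n + m - 1)\<^esub> j\<in>{1..m}.
            (basis_col (n + m - 1) (i + j - 1))\<^sup>T \<otimes>\<^sub>K basis_col m j \<otimes>\<^sub>K basis_col n i)"
proof -
  let ?N = "n + m - 1"
  let ?M = "module_mat TYPE(real) (n * m) ?N"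
  define D where "D = (\<Oplus>\<^bsub>?M\<^esub> i\<in>{1..n}. \<Oplus>\<^bsub>?M\<^esub> j\<in>{1..m}. duplication_term n m i j)"
  have D: "D \<in> carrier_mat (n * m) ?N"
    unfolding D_def by (intro finsum_module_mat_closed duplication_term_carrier)
  have bounds: "r div n < m" "r mod n < n" if "r < n * m" for r
    using that assms by (auto simp: less_mult_imp_div_less mult.commute)
  have index: "D $$ (r, c) = of_bool (c = r div n + r mod n)"
    if r: "r < n * m" and c: "c < ?N" for r c
  proof -
    have "D $$ (r, c) = (\<Sum>i\<in>{1..n}. \<Sum>j\<in>{1..m}. duplication_term n m i j $$ (r, c))"
      unfolding D_def using r c
      by (simp add: index_finsum_module_mat finsum_module_mat_closed duplication_term_carrier
          del: One_nat_def)
    \<comment> \<open>Nested conditionals make each of the two sums a sum over a Kronecker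
      delta.\<close>
    also have "\<dots> = (\<Sum>i\<in>{1..n}. \<Sum>j\<in>{1..m}.
        if i = r mod n + 1 then if j = r div n + 1 then of_bool (c = r div n + r mod n) else 0 else 0)"
      using r c by (intro sum.cong refl, subst index_duplication_term) auto
    also have "\<dots> = (\<Sum>i\<in>{1..n}. if i = r mod n + 1 then
        \<Sum>j\<in>{1..m}. if j = r div n + 1 then of_bool (c = r div n + r mod n) else 0 else 0)"
      by (intro sum.cong refl) simp
    \<comment> \<open>The bounds on remainder and quotient place \<open>r mod n + 1\<close> in
      \<open>{1..n}\<close> and \<open>r div n + 1\<close> in \<open>{1..m}\<close>, so one pair
      survives.\<close>
    also have "\<dots> = of_bool (c = r div n + r mod n)"
      using bounds[OF r] by (simp add: Suc_le_eq)
    finally show ?thesis .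
  qed
  have "D *\<^sub>v vecL_mat A = vec_mat A" if hankel: "A \<in> hankel_mats n m" for A
  proof -
    from hankel obtain a :: "nat \<Rightarrow> real" where A: "A \<in> carrier_mat n m"
      and a: "\<And>i j. i < n \<Longrightarrow> j < m \<Longrightarrow> A $$ (i, j) = a (i + j + 1)"
      by (auto simp: hankel_mats_def)
    have vecL: "vecL_mat A = vec ?N (\<lambda>k. a (k + 1))"
      by (rule vecL_mat_hankel[OF A assms a])
    show ?thesis
    proof (rule eq_vecI)
      fix r assume "r < dim_vec (vec_mat A)"
      then have r: "r < n * m" using A by (simp add: vec_mat_eq)
      have "(D *\<^sub>v vecL_mat A) $ r = (\<Sum>c<?N. D $$ (r, c) * a (c + 1))"
        using D r by (auto simp: vecL scalar_prod_def atLeast0LessThan intro!: sum.cong)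
      also have "\<dots> = (\<Sum>c<?N. if c = r div n + r mod n then a (c + 1) else 0)"
        using r by (intro sum.cong) (simp_all add: index)
      \<comment> \<open>The selected column is at most \<open>(m - 1) + (n - 1)\<close>, hence
        within the range of summation.\<close>
      also have "\<dots> = a (r mod n + r div n + 1)"
        using bounds[OF r] by (simp add: add.commute)
      also have "\<dots> = vec_mat A $ r"
        using A a bounds[OF r] r by (simp add: vec_mat_eq)
      finally show "(D *\<^sub>v vecL_mat A) $ r = vec_mat A $ r" .
    qed (use A D in \<open>simp add: vec_mat_eq\<close>)
  qed
  with D show ?thesis unfolding D_def by blast
qed

end
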